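(* Let $V\cong\mathbb Z^d$, let $W$ be a free abelian group, let $\beta:\wedge^2V\twoheadrightarrow W$ be an epimorphism, and let $L=\ker\beta$. There is a bijection between $X_L(\mathbb Q)$ and the rank-one rational subspaces of $L_{\mathbb Q}$ generated by nonzero decomposable elements (a rational point being regarded as a one-dimensional $\mathbb Q$-subspace $P$ of $L_{\mathbb Q}$). Furthermore, if for $P\in X_L(\mathbb Q)$ we let $q_P$ denote the primitive integral generator of $P\cap L$, then $$D_\beta=\langle q_P\mid P\in X_L(\mathbb Q)\rangle_{\mathbb Z}.$$ In particular, $D_\beta$ is nontrivial if and only if $X_L(\mathbb Q)$ is nonempty.
   Context: $V_{\mathbb Q}=V\otimes\mathbb Q$ and $L_{\mathbb Q}=L\otimes\mathbb Q\le\wedge^2V_{\mathbb Q}$. An element of $\wedge^2V_{\mathbb Q}$ is decomposable if it has the form $u\wedge v$ with $u,v\in V_{\mathbb Q}$. $D_\beta=\langle a\wedge b\mid a,b\in V,\ \beta(a\wedge b)=0\rangle\le L$. $X_L=\mathbb P(L_{\mathbb Q})\cap\operatorname{Gr}(2,V_{\mathbb Q})$, where $\operatorname{Gr}(2,V_{\mathbb Q})\subset\mathbb P(\wedge^2V_{\mathbb Q})$ is the Grassmannian in its Plücker embedding; $X_L(\mathbb Q)$ is the set of its $\mathbb Q$-rational points. For a one-dimensional subspace $P\le L_{\mathbb Q}$, the group $P\cap L$ is infinite cyclic and $q_P$ is a generator (unique up to sign). *)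

theory Defs
  imports Complex_Main "HOL-Library.Function_Algebras"
begin

(* Free modules are coordinate functions with pointwise addition (Function_Algebras); the
   ambient function type is too large, the modules meant are the carrier sets below. *)

definition fscale :: "'r::comm_ring_1 \<Rightarrow> ('i \<Rightarrow> 'r) \<Rightarrow> 'i \<Rightarrow> 'r" where
  "fscale c x = (\<lambda>i. c * x i)"

lemma module_fscale: "module (fscale :: 'r::comm_ring_1 \<Rightarrow> ('i \<Rightarrow> 'r) \<Rightarrow> _)"
  by unfold_locales (auto simp: fscale_def fun_eq_iff algebra_simps)

lemma vector_space_fscale: "vector_space (fscale :: 'r::field \<Rightarrow> ('i \<Rightarrow> 'r) \<Rightarrow> _)"
  by unfold_locales (auto simp: fscale_def fun_eq_iff algebra_simps)

abbreviation int_span :: "('i \<Rightarrow> int) set \<Rightarrow> ('i \<Rightarrow> int) set" where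
  "int_span \<equiv> module.span fscale"

abbreviation rat_span :: "('i \<Rightarrow> rat) set \<Rightarrow> ('i \<Rightarrow> rat) set" where
  "rat_span \<equiv> module.span fscale"

abbreviation rat_subspace :: "('i \<Rightarrow> rat) set \<Rightarrow> bool" where
  "rat_subspace \<equiv> module.subspace fscale"

abbreviation rat_dim :: "('i \<Rightarrow> rat) set \<Rightarrow> nat" where
  "rat_dim \<equiv> vector_space.dim fscale"

(* The Z-module structure of an abelian group is unique, so s is no extra datum. *)
definition free_abelian :: "'w::ab_group_add itself \<Rightarrow> bool" where
  "free_abelian _ \<longleftrightarrow>
     (\<exists>(s :: int \<Rightarrow> 'w \<Rightarrow> 'w) B. module s \<and> \<not> module.dependent s B \<and> module.span s B = UNIV)"

(* R^d; for R = int this is V, for R = rat it is V tensor Q. *)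
definition coord_space :: "nat \<Rightarrow> (nat \<Rightarrow> 'r::comm_ring_1) set" where
  "coord_space d = {x. \<forall>i\<ge>d. x i = 0}"

(* The exterior square of R^d is the free module on the e_i /\ e_j with i < j < d, so that
   wedge u v lists the 2x2 minors (Pluecker coordinates) of the pair u, v. The lemmas
   ext_square_universal and ext_square_unique below establish its universal property. *)
definition ext_square :: "nat \<Rightarrow> (nat \<times> nat \<Rightarrow> 'r::comm_ring_1) set" where
  "ext_square d = {w. \<forall>i j. \<not> (i < j \<and> j < d) \<longrightarrow> w (i, j) = 0}"

definition wedge :: "(nat \<Rightarrow> 'r::comm_ring_1) \<Rightarrow> (nat \<Rightarrow> 'r) \<Rightarrow> nat \<times> nat \<Rightarrow> 'r" where
  "wedge u v = (\<lambda>(i, j). if i < j then u i * v j - u j * v i else 0)"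

definition linear_on ::
  "('r::comm_ring_1 \<Rightarrow> 'm::ab_group_add \<Rightarrow> 'm) \<Rightarrow> ('i \<Rightarrow> 'r) set \<Rightarrow> (('i \<Rightarrow> 'r) \<Rightarrow> 'm) \<Rightarrow> bool" where
  "linear_on s A g \<longleftrightarrow>
     (\<forall>x\<in>A. \<forall>y\<in>A. g (x + y) = g x + g y) \<and> (\<forall>c. \<forall>x\<in>A. g (fscale c x) = s c (g x))"

definition unit_coord :: "nat \<Rightarrow> nat \<Rightarrow> 'r::comm_ring_1" where
  "unit_coord i = (\<lambda>j. if j = i then 1 else 0)"

lemma wedge_in_ext_square:
  "u \<in> coord_space d \<Longrightarrow> v \<in> coord_space d \<Longrightarrow> wedge u v \<in> ext_square d"
  by (auto simp: coord_space_def ext_square_def wedge_def)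

lemma subspace_coord_space: "module.subspace fscale (coord_space d :: (nat \<Rightarrow> 'r::comm_ring_1) set)"
  by (subst module.subspace_def[OF module_fscale]) (auto simp: coord_space_def fscale_def)

lemma subspace_ext_square:
  "module.subspace fscale (ext_square d :: (nat \<times> nat \<Rightarrow> 'r::comm_ring_1) set)"
  by (subst module.subspace_def[OF module_fscale]) (auto simp: ext_square_def fscale_def)

lemma unit_coord_in: "i < d \<Longrightarrow> unit_coord i \<in> coord_space d"
  by (auto simp: unit_coord_def coord_space_def)

lemma linear_on_sum:
  assumes s: "module s" and A: "module.subspace fscale A" and g: "linear_on s A g"
    and F: "finite I" "\<And>i. i \<in> I \<Longrightarrow> x i \<in> A"
  shows "g (\<Sum>i\<in>I. fscale (c i) (x i)) = (\<Sum>i\<in>I. s (c i) (g (x i)))"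
proof -
  interpret f: module "fscale :: 'a \<Rightarrow> ('c \<Rightarrow> 'a) \<Rightarrow> _" by (rule module_fscale)
  have g0: "g 0 = 0"
    using g f.subspace_0[OF A] unfolding linear_on_def by (metis add_0 add_cancel_right_right)
  show ?thesis using F
  proof (induction I rule: finite_induct)
    case (insert i I)
    have "(\<Sum>i\<in>I. fscale (c i) (x i)) \<in> A"
      using insert A by (intro f.subspace_sum f.subspace_scale) auto
    moreover have "fscale (c i) (x i) \<in> A" using insert A by (auto intro: f.subspace_scale)
    ultimately have "g (fscale (c i) (x i) + (\<Sum>i\<in>I. fscale (c i) (x i)))
        = s (c i) (g (x i)) + g (\<Sum>i\<in>I. fscale (c i) (x i))"
      using insert.prems g unfolding linear_on_def by (metis insertI1)
    then show ?case using insert by (simp del: plus_fun_apply)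
  qed (simp add: g0)
qed

lemma fun_sum_apply: "(\<Sum>i\<in>I. F i) x = (\<Sum>i\<in>I. F i x)" for F :: "_ \<Rightarrow> _ \<Rightarrow> _::comm_monoid_add"
  by (induction I rule: infinite_finite_induct) auto

lemma coord_space_expand:
  assumes "u \<in> coord_space d"
  shows "u = (\<Sum>i<d. fscale (u i) (unit_coord i))"
proof
  fix k
  have "(\<Sum>i<d. u i * (if k = i then 1 else 0)) = (if k < d then u k else 0)"
    by (simp add: if_distrib cong: if_cong)
  with assms show "u k = (\<Sum>i<d. fscale (u i) (unit_coord i)) k"
    by (auto simp: fun_sum_apply fscale_def unit_coord_def coord_space_def)
qed

lemma ext_square_expand:
  assumes "w \<in> ext_square d"
  shows "w = (\<Sum>p\<in>{(i, j). i < j \<and> j < d}.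
           fscale (w p) (wedge (unit_coord (fst p)) (unit_coord (snd p))))"
proof
  fix k :: "nat \<times> nat"
  let ?I = "{(i, j). i < j \<and> j < d}"
  have fin: "finite ?I" by (rule finite_subset[of _ "{..<d} \<times> {..<d}"]) auto
  have "(\<Sum>p\<in>?I. w p * wedge (unit_coord (fst p)) (unit_coord (snd p)) k)
      = (\<Sum>p\<in>?I. if p = k then w k else 0)"
    by (rule sum.cong) (auto simp: wedge_def unit_coord_def split: prod.splits)
  also have "\<dots> = w k" using assms fin by (cases k) (auto simp: ext_square_def)
  finally show "w k = (\<Sum>p\<in>?I. fscale (w p) (wedge (unit_coord (fst p)) (unit_coord (snd p)))) k"
    by (simp add: fun_sum_apply fscale_def)
qed

lemma ext_square_unique:
  assumes "module s" "linear_on s (ext_square d) g" "linear_on s (ext_square d) g'"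
    and eq: "\<And>u v. u \<in> coord_space d \<Longrightarrow> v \<in> coord_space d \<Longrightarrow> g (wedge u v) = g' (wedge u v)"
    and w: "w \<in> ext_square d"
  shows "g w = g' w"
proof -
  let ?I = "{(i, j). i < j \<and> j < d}"
  let ?e = "\<lambda>p. wedge (unit_coord (fst p)) (unit_coord (snd p))"
  have fin: "finite ?I" by (rule finite_subset[of _ "{..<d} \<times> {..<d}"]) auto
  have e: "?e p \<in> ext_square d" if "p \<in> ?I" for p
    using that by (auto intro!: wedge_in_ext_square unit_coord_in)
  have *: "h w = (\<Sum>p\<in>?I. s (w p) (h (?e p)))" if "linear_on s (ext_square d) h" for h
    by (subst ext_square_expand[OF w])
       (rule linear_on_sum[OF assms(1) subspace_ext_square that fin e])
  show ?thesis unfolding *[OF assms(2)] *[OF assms(3)]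
    by (rule sum.cong) (auto intro!: arg_cong[where f = "s _"] eq unit_coord_in)
qed

lemma sum_square_split:
  fixes F :: "nat \<Rightarrow> nat \<Rightarrow> 'm::comm_monoid_add"
  assumes "\<And>i. i < d \<Longrightarrow> F i i = 0"
  shows "(\<Sum>i<d. \<Sum>j<d. F i j) = (\<Sum>j<d. \<Sum>i<j. F i j + F j i)"
  using assms by (induction d) (simp_all add: sum.distrib ac_simps)

lemma ext_square_universal:
  fixes f :: "(nat \<Rightarrow> 'r::comm_ring_1) \<Rightarrow> (nat \<Rightarrow> 'r) \<Rightarrow> 'm::ab_group_add"
  assumes s: "module s"
    and l: "\<And>v. v \<in> coord_space d \<Longrightarrow> linear_on s (coord_space d) (\<lambda>u. f u v)"
    and r: "\<And>u. u \<in> coord_space d \<Longrightarrow> linear_on s (coord_space d) (f u)"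
    and alt: "\<And>u. u \<in> coord_space d \<Longrightarrow> f u u = 0"
  shows "\<exists>g. linear_on s (ext_square d) g \<and>
           (\<forall>u\<in>coord_space d. \<forall>v\<in>coord_space d. g (wedge u v) = f u v)"
proof (intro exI conjI ballI)
  interpret s: module s by (rule s)
  let ?e = "unit_coord :: nat \<Rightarrow> nat \<Rightarrow> 'r"
  let ?g = "\<lambda>w. \<Sum>j<d. \<Sum>i<j. s (w (i, j)) (f (?e i) (?e j))"
  show "linear_on s (ext_square d) ?g"
    by (simp add: linear_on_def fscale_def s.scale_left_distrib sum.distrib s.scale_sum_right)
  fix u v :: "nat \<Rightarrow> 'r" assume u: "u \<in> coord_space d" and v: "v \<in> coord_space d"
  have anti: "f (?e j) (?e i) = - f (?e i) (?e j)" if "i < d" "j < d" for i j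
  proof -
    have e: "?e i \<in> coord_space d" "?e j \<in> coord_space d" using that by (auto intro: unit_coord_in)
    then have ij: "?e i + ?e j \<in> coord_space d"
      using module.subspace_add[OF module_fscale subspace_coord_space] by blast
    have "0 = f (?e i + ?e j) (?e i + ?e j)" using alt[OF ij] by simp
    also have "\<dots> = f (?e i) (?e i + ?e j) + f (?e j) (?e i + ?e j)"
      using l[OF ij] e by (simp add: linear_on_def)
    also have "\<dots> = f (?e i) (?e j) + f (?e j) (?e i)"
      using r[OF e(1)] r[OF e(2)] e alt by (simp add: linear_on_def)
    finally show ?thesis by (simp add: eq_neg_iff_add_eq_0 add.commute)
  qed
  have "f u v = (\<Sum>i<d. s (u i) (f (?e i) v))"
    by (subst coord_space_expand[OF u],
        rule linear_on_sum[OF s subspace_coord_space l[OF v]]) (auto intro: unit_coord_in)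
  also have "\<dots> = (\<Sum>i<d. s (u i) (\<Sum>j<d. s (v j) (f (?e i) (?e j))))"
  proof (rule sum.cong[OF refl])
    fix i assume "i \<in> {..<d}"
    then have "?e i \<in> coord_space d" by (auto intro: unit_coord_in)
    from linear_on_sum[OF s subspace_coord_space r[OF this], of "{..<d}" ?e v]
    show "s (u i) (f (?e i) v) = s (u i) (\<Sum>j<d. s (v j) (f (?e i) (?e j)))"
      using coord_space_expand[OF v] by (simp add: unit_coord_in)
  qed
  also have "\<dots> = (\<Sum>i<d. \<Sum>j<d. s (u i * v j) (f (?e i) (?e j)))"
    by (simp add: s.scale_sum_right)
  also have "\<dots> = (\<Sum>j<d. \<Sum>i<j. s (u i * v j) (f (?e i) (?e j)) + s (u j * v i) (f (?e j) (?e i)))"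
    by (rule sum_square_split) (simp add: alt unit_coord_in)
  also have "\<dots> = ?g (wedge u v)"
  proof (intro sum.cong refl)
    fix i j assume "j \<in> {..<d}" "i \<in> {..<j}"
    then have "f (?e j) (?e i) = - f (?e i) (?e j)" and "wedge u v (i, j) = u i * v j - u j * v i"
      by (auto intro: anti simp: wedge_def)
    then show "s (u i * v j) (f (?e i) (?e j)) + s (u j * v i) (f (?e j) (?e i))
        = s (wedge u v (i, j)) (f (?e i) (?e j))"
      by (simp add: s.scale_left_diff_distrib)
  qed
  finally show "?g (wedge u v) = f u v" ..
qed

(* The embedding of the exterior square of V into that of V tensor Q. *)
definition to_rat :: "('i \<Rightarrow> int) \<Rightarrow> 'i \<Rightarrow> rat" where
  "to_rat w = (\<lambda>p. of_int (w p))"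

(* L tensor Q, as a subspace of the exterior square of V tensor Q. *)
definition rationalization :: "('i \<Rightarrow> int) set \<Rightarrow> ('i \<Rightarrow> rat) set" where
  "rationalization L = rat_span (to_rat ` L)"

definition decomposable :: "nat \<Rightarrow> (nat \<times> nat \<Rightarrow> rat) \<Rightarrow> bool" where
  "decomposable d w \<longleftrightarrow> (\<exists>u\<in>coord_space d. \<exists>v\<in>coord_space d. w = wedge u v)"

definition proj_space :: "('i \<Rightarrow> rat) set \<Rightarrow> ('i \<Rightarrow> rat) set set" where
  "proj_space E = {P. rat_subspace P \<and> P \<subseteq> E \<and> rat_dim P = 1}"

(* The rational points of Gr(2, Q^d) are the planes of Q^d ... *)
definition grassmannian2 :: "nat \<Rightarrow> (nat \<Rightarrow> rat) set set" where
  "grassmannian2 d = {U. rat_subspace U \<and> U \<subseteq> coord_space d \<and> rat_dim U = 2}"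

(* ... and the Pluecker embedding sends a plane U to its exterior square, a line. *)
definition pluecker :: "(nat \<Rightarrow> rat) set \<Rightarrow> (nat \<times> nat \<Rightarrow> rat) set" where
  "pluecker U = rat_span {wedge u v | u v. u \<in> U \<and> v \<in> U}"

definition X_points :: "nat \<Rightarrow> (nat \<times> nat \<Rightarrow> int) set \<Rightarrow> (nat \<times> nat \<Rightarrow> rat) set set" where
  "X_points d L = proj_space (rationalization L) \<inter> pluecker ` grassmannian2 d"

definition ext_kernel ::
  "nat \<Rightarrow> ((nat \<times> nat \<Rightarrow> int) \<Rightarrow> 'w::ab_group_add) \<Rightarrow> (nat \<times> nat \<Rightarrow> int) set" where
  "ext_kernel d \<beta> = {w \<in> ext_square d. \<beta> w = 0}"

definition D_group ::
  "nat \<Rightarrow> ((nat \<times> nat \<Rightarrow> int) \<Rightarrow> 'w::ab_group_add) \<Rightarrow> (nat \<times> nat \<Rightarrow> int) set" where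
  "D_group d \<beta> =
     int_span {wedge a b | a b. a \<in> coord_space d \<and> b \<in> coord_space d \<and> \<beta> (wedge a b) = 0}"

(* The group P \<inter> L is infinite cyclic, generated by q (q \<noteq> 0 suffices for infinite order,
   as the ambient group is torsion-free). *)
definition primitive_generator ::
  "('i \<Rightarrow> int) set \<Rightarrow> ('i \<Rightarrow> rat) set \<Rightarrow> ('i \<Rightarrow> int) \<Rightarrow> bool" where
  "primitive_generator L P q \<longleftrightarrow> q \<noteq> 0 \<and> {w \<in> L. to_rat w \<in> P} = int_span {q}"

end

theory Submission
  imports Defs "HOL-Computational_Algebra.Primes"
begin

text \<open>
  The minors of an integral pair \<open>a, b\<close> are all divisible by a prime \<open>p\<close> only if \<open>a\<close> and \<open>b\<close> are
  dependent modulo \<open>p\<close>; then one of \<open>a\<close> and \<open>b + t a\<close> can be divided by \<open>p\<close>, so \<open>a \<and> b\<close> is \<open>p\<close>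
  times an integral decomposable vector. Hence an integral vector that is decomposable over the
  rationals is decomposable over the integers, and every \<open>q\<^sub>P\<close> is one of the generators \<open>a \<and> b\<close> of
  \<open>D\<^sub>\<beta>\<close>. Conversely a nonzero generator \<open>a \<and> b\<close> spans a rational point \<open>P\<close>, and so it is an
  integral multiple of \<open>q\<^sub>P\<close>.
\<close>

interpretation rat: vector_space "fscale :: rat \<Rightarrow> ('i \<Rightarrow> rat) \<Rightarrow> 'i \<Rightarrow> rat"
  by (rule vector_space_fscale)

interpretation int: module "fscale :: int \<Rightarrow> ('i \<Rightarrow> int) \<Rightarrow> 'i \<Rightarrow> int"
  by (rule module_fscale)

section \<open>Algebra of \<open>wedge\<close> and of the embedding \<open>to_rat\<close>\<close>

lemma wedge_0_right [simp]: "wedge u 0 = 0"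
  by (auto simp: wedge_def fun_eq_iff)

lemma wedge_fscale_left: "wedge (fscale c u) v = fscale c (wedge u v)"
  and wedge_fscale_right: "wedge u (fscale c v) = fscale c (wedge u v)"
  by (auto simp: wedge_def fscale_def fun_eq_iff algebra_simps)

text \<open>The scalar is the determinant of the coefficient matrix, so all wedges of vectors from
  one plane are proportional.\<close>

lemma wedge_linear_combinations:
  "wedge (fscale a u + fscale b v) (fscale c u + fscale e v) = fscale (a * e - b * c) (wedge u v)"
  by (auto simp: wedge_def fscale_def fun_eq_iff algebra_simps)

lemma wedge_add_fscale: "wedge u (v + fscale t u) = wedge u v"
  by (auto simp: wedge_def fscale_def fun_eq_iff algebra_simps)

lemma to_rat_0 [simp]: "to_rat 0 = 0"
  and to_rat_add: "to_rat (x + y) = to_rat x + to_rat y"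
  and to_rat_fscale: "to_rat (fscale c x) = fscale (of_int c) (to_rat x)"
  by (auto simp: to_rat_def fscale_def fun_eq_iff)

lemma to_rat_eq_iff [simp]: "to_rat x = to_rat y \<longleftrightarrow> x = y"
  by (auto simp: to_rat_def fun_eq_iff)

lemma to_rat_eq_0_iff [simp]: "to_rat x = 0 \<longleftrightarrow> x = 0"
  using to_rat_eq_iff[of x 0] by (simp del: to_rat_eq_iff)

lemma to_rat_wedge: "to_rat (wedge a b) = wedge (to_rat a) (to_rat b)"
  by (auto simp: wedge_def to_rat_def fun_eq_iff)

lemma to_rat_in_coord_space: "to_rat a \<in> coord_space d \<longleftrightarrow> a \<in> coord_space d"
  by (auto simp: coord_space_def to_rat_def)

lemma fscale_eq_0_iff: "fscale c x = 0 \<longleftrightarrow> c = 0 \<or> x = 0" for x :: "'i \<Rightarrow> 'r::idom"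
  by (auto simp: fscale_def fun_eq_iff)

lemma fscale_cancel: "c \<noteq> 0 \<Longrightarrow> fscale c x = fscale c y \<longleftrightarrow> x = y" for x :: "'i \<Rightarrow> 'r::idom"
  by (auto simp: fscale_def fun_eq_iff)

section \<open>Planes, their Pluecker lines and nonzero decomposable vectors\<close>

lemma rat_dim_span_singleton: "x \<noteq> 0 \<Longrightarrow> rat_dim (rat_span {x}) = 1"
  using rat.dim_span_eq_card_independent[of "{x}"] by simp

lemma pluecker_span_pair: "pluecker (rat_span {u, v}) = rat_span {wedge u v}"
proof -
  have combination: "\<exists>a b. x = fscale a u + fscale b v" if x: "x \<in> rat_span {u, v}" for x
  proof -
    obtain a where "x - fscale a u \<in> rat_span {v}"
      using x rat.span_breakdown_eq by blast
    then obtain b where "x - fscale a u = fscale b v"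
      using rat.span_singleton by blast
    then show ?thesis
      by (metis add.commute diff_add_cancel)
  qed
  have "wedge x y \<in> rat_span {wedge u v}" if "x \<in> rat_span {u, v}" "y \<in> rat_span {u, v}" for x y
  proof -
    from that obtain a b c e where "x = fscale a u + fscale b v" "y = fscale c u + fscale e v"
      using combination by metis
    then show ?thesis
      by (simp only: wedge_linear_combinations) (simp add: rat.span_scale rat.span_base)
  qed
  moreover have "u \<in> rat_span {u, v}" "v \<in> rat_span {u, v}"
    by (simp_all add: rat.span_base)
  then have "wedge u v \<in> pluecker (rat_span {u, v})"
    unfolding pluecker_def by (intro rat.span_base) blast
  ultimately show ?thesis
    unfolding pluecker_def by (intro rat.span_eq[THEN iffD2]) auto
qed

lemma rat_dim_span_pair:
  assumes "wedge u v \<noteq> 0"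
  shows "rat_dim (rat_span {u, v}) = 2"
proof -
  have "wedge (fscale c v) v = 0" for c
    by (auto simp: wedge_def fscale_def fun_eq_iff)
  then have u: "u \<notin> rat_span {v}"
    using assms by (auto simp: rat.span_singleton)
  then have "u \<noteq> v" and "v \<noteq> 0"
    using assms rat.span_base by auto
  then have "\<not> rat.dependent {u, v}"
    using u by (simp add: rat.independent_insert)
  then show ?thesis
    using rat.dim_span_eq_card_independent \<open>u \<noteq> v\<close> by fastforce
qed

text \<open>A basis \<open>u\<close>, \<open>v\<close> of a plane yields the generator
  \<open>wedge u v\<close> of its Pluecker line; conversely, the factors of a nonzero decomposable
  vector span a plane with that line.\<close>

lemma pluecker_image_eq:
  "pluecker ` grassmannian2 d = {rat_span {\<omega>} | \<omega>. \<omega> \<noteq> 0 \<and> decomposable d \<omega>}"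
proof (intro equalityI subsetI)
  fix P assume "P \<in> pluecker ` grassmannian2 d"
  then obtain U where U: "rat_subspace U" "U \<subseteq> coord_space d" "rat_dim U = 2" and P: "P = pluecker U"
    by (auto simp: grassmannian2_def)
  obtain B where B: "B \<subseteq> U" "\<not> rat.dependent B" "U \<subseteq> rat_span B" "card B = rat_dim U"
    by (rule rat.basis_exists)
  then obtain u v where uv: "B = {u, v}" "u \<noteq> v"
    using U(3) by (metis card_2_iff)
  have "U = rat_span {u, v}"
    using B U(1) uv rat.span_minimal by blast
  then have "P = rat_span {wedge u v}"
    by (simp add: P pluecker_span_pair)
  moreover have "decomposable d (wedge u v)"
    using B U(2) uv by (auto simp: decomposable_def)
  moreover have "wedge u v \<noteq> 0"
  proof
    assume w: "wedge u v = 0"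
    have "v \<noteq> 0" "u \<notin> rat_span {v}"
      using B(2) uv rat.dependent_zero[of B] by (auto simp: rat.independent_insert)
    moreover obtain k where k: "v k \<noteq> 0"
      using \<open>v \<noteq> 0\<close> by (auto simp: fun_eq_iff)
    \<comment> \<open>\<open>wedge\<close> stores a minor only for increasing indices, so the index
      pair is read in both orders. Vanishing of all minors makes \<open>u\<close> proportional to
      \<open>v\<close>, with the ratio read off at \<open>k\<close>, against independence of the
      basis.\<close>
    have "u i * v j = u j * v i" for i j
      using fun_cong[OF w, of "(i, j)"] fun_cong[OF w, of "(j, i)"]
      by (cases i j rule: linorder_cases) (auto simp: wedge_def)
    then have "u = fscale (u k / v k) v"
      using k by (auto simp: fscale_def fun_eq_iff field_simps)
    ultimately show False
      by (auto simp: rat.span_singleton)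
  qed
  ultimately show "P \<in> {rat_span {\<omega>} | \<omega>. \<omega> \<noteq> 0 \<and> decomposable d \<omega>}"
    by blast
next
  fix P assume "P \<in> {rat_span {\<omega>} | \<omega>. \<omega> \<noteq> 0 \<and> decomposable d \<omega>}"
  then obtain u v where uv: "u \<in> coord_space d" "v \<in> coord_space d" "wedge u v \<noteq> 0"
    and P: "P = rat_span {wedge u v}"
    by (auto simp: decomposable_def)
  have "rat_span {u, v} \<subseteq> coord_space d"
    using uv by (intro rat.span_minimal subspace_coord_space) auto
  then have "rat_span {u, v} \<in> grassmannian2 d"
    using uv by (simp add: grassmannian2_def rat_dim_span_pair del: rat.dim_span)
  then show "P \<in> pluecker ` grassmannian2 d"
    using P pluecker_span_pair by blast
qed

section \<open>From rational to integral decomposability\<close>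

lemma wedge_prime_factor:
  fixes a b :: "nat \<Rightarrow> int"
  assumes ab: "a \<in> coord_space d" "b \<in> coord_space d" and p: "prime p"
    and w: "wedge a b = fscale p w"
  shows "\<exists>a'\<in>coord_space d. \<exists>b'\<in>coord_space d. w = wedge a' b'"
proof -
  have p0: "p \<noteq> 0"
    using p by auto
  have divide: "\<exists>x'\<in>coord_space d. x = fscale p x'"
    if "x \<in> coord_space d" "\<And>i. p dvd x i" for x :: "nat \<Rightarrow> int"
    using that p0 by (intro bexI[of _ "\<lambda>i. x i div p"]) (auto simp: coord_space_def fscale_def)
  have minor: "p dvd a i * b j - a j * b i" for i j
  proof -
    have "p dvd a i * b j - a j * b i" if "i < j" for i j
      using fun_cong[OF w, of "(i, j)"] that by (simp add: wedge_def fscale_def)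
    then show ?thesis
      by (metis dvd_minus_iff minus_diff_eq diff_self dvd_0_right linorder_neqE_nat mult.commute)
  qed
  show ?thesis
  proof (cases "\<forall>i. p dvd a i")
    case True
    then obtain a' where "a' \<in> coord_space d" "a = fscale p a'"
      using divide ab by blast
    then show ?thesis
      using w ab p0 by (metis wedge_fscale_left fscale_cancel)
  next
    case False
    then obtain k where k: "\<not> p dvd a k"
      by blast
    then have "coprime (a k) p"
      using p by (metis coprime_commute prime_imp_coprime)
    then obtain c e where ce: "a k * c + p * e = 1"
      by (metis bezout_int coprime_iff_gcd_eq_1 mult.commute)
    \<comment> \<open>By the Bezout identity \<open>c\<close> inverts \<open>a k\<close> modulo
      \<open>p\<close>, so this \<open>t\<close> is the multiple of \<open>a\<close> that cancels
      \<open>b\<close> at coordinate \<open>k\<close> modulo \<open>p\<close>.\<close>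
    define t where "t = - (c * b k)"
    have "p dvd b j + t * a j" for j
    proof -
      \<comment> \<open>The right side is a minor, a multiple of \<open>p\<close>, and a term that
        vanishes by Bezout. As \<open>p\<close> does not divide \<open>a k\<close>, it divides the
        other factor.\<close>
      have "a k * (b j + t * a j) = (a k * b j - a j * b k) + p * (e * b k * a j)
          + (1 - (a k * c + p * e)) * b k * a j"
        by (simp add: t_def algebra_simps)
      also have "p dvd \<dots>"
        using minor[of k j] by (simp add: ce)
      finally show ?thesis
        using k p prime_dvd_multD by blast
    qed
    moreover have "b + fscale t a \<in> coord_space d"
      using ab by (auto simp: coord_space_def fscale_def)
    ultimately obtain b' where "b' \<in> coord_space d" "b + fscale t a = fscale p b'"
      using divide[of "b + fscale t a"] by (auto simp: fscale_def)
    then show ?thesis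
      using w ab p0 by (metis wedge_add_fscale wedge_fscale_right fscale_cancel)
  qed
qed

text \<open>One prime factor of \<open>n\<close> is removed at a time. Each removal changes the pair
  of factors, so the induction is over arbitrary \<open>a\<close> and \<open>b\<close>.\<close>

lemma wedge_factor:
  fixes a b :: "nat \<Rightarrow> int"
  assumes "n > 0" "a \<in> coord_space d" "b \<in> coord_space d" "wedge a b = fscale (int n) w"
  shows "\<exists>a'\<in>coord_space d. \<exists>b'\<in>coord_space d. w = wedge a' b'"
  using assms
proof (induction n arbitrary: a b rule: less_induct)
  case (less n)
  show ?case
  proof (cases "n = 1")
    case True
    then show ?thesis
      using less.prems by auto
  next
    case False
    then obtain p m where p: "prime p" and n: "n = p * m"
      using prime_factor_nat by blast
    then have m: "0 < m" "m < n"
      using less.prems prime_gt_1_nat by auto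
    have "wedge a b = fscale (int p) (fscale (int m) w)"
      using less.prems n by simp
    then obtain a' b' where "a' \<in> coord_space d" "b' \<in> coord_space d" "fscale (int m) w = wedge a' b'"
      using wedge_prime_factor less.prems p by (metis prime_nat_int_transfer)
    then show ?thesis
      using less.IH[OF m(2,1)] by metis
  qed
qed

lemma common_denominator:
  fixes u :: "nat \<Rightarrow> rat"
  assumes "u \<in> coord_space d"
  obtains n a where "n > 0" "a \<in> coord_space d" "fscale (of_nat n) u = to_rat a"
proof -
  define den where "den i = nat (snd (quotient_of (u i)))" for i
  \<comment> \<open>A finite product suffices, because the coordinates from \<open>d\<close> on are
    zero.\<close>
  define n where "n = (\<Prod>i<d. den i)"
  have den: "den i > 0" "\<exists>k. of_nat (den i) * u i = of_int k" for i
  proof -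
    obtain x y where xy: "quotient_of (u i) = (x, y)"
      by fastforce
    then have "y > 0" "u i = of_int x / of_int y"
      using quotient_of_denom_pos quotient_of_div by blast+
    then show "den i > 0" "\<exists>k. of_nat (den i) * u i = of_int k"
      using xy by (auto simp: den_def intro!: exI[of _ x])
  qed
  have "\<exists>k. of_nat n * u i = of_int k" for i
  proof (cases "i < d")
    case True
    then have "den i dvd n"
      by (auto simp: n_def)
    then obtain m where "n = m * den i"
      by (metis dvd_def mult.commute)
    then show ?thesis
      using den(2)[of i] by (metis mult.assoc of_nat_mult of_int_mult of_int_of_nat_eq)
  next
    case False
    then show ?thesis
      using assms by (auto simp: coord_space_def intro!: exI[of _ 0])
  qed
  then obtain a where a: "\<And>i. of_nat n * u i = of_int (a i)"
    by metis
  then have eq: "fscale (of_nat n) u = to_rat a"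
    by (auto simp: fscale_def to_rat_def)
  then have "to_rat a \<in> coord_space d"
    using assms rat.subspace_scale subspace_coord_space by metis
  then show thesis
    using that[of n a] den(1) eq by (auto simp: to_rat_in_coord_space n_def prod_pos)
qed

text \<open>Clearing the denominators of the two rational factors separately gives an integral pair
  whose wedge is \<open>m * n\<close> times \<open>w\<close>; \<open>wedge_factor\<close> then
  removes this multiple.\<close>

lemma decomposable_to_rat_obtain:
  assumes "decomposable d (to_rat w)"
  obtains a b where "a \<in> coord_space d" "b \<in> coord_space d" "w = wedge a b"
proof -
  obtain u v where uv: "u \<in> coord_space d" "v \<in> coord_space d" "to_rat w = wedge u v"
    using assms by (auto simp: decomposable_def)
  obtain m a where a: "m > 0" "a \<in> coord_space d" "fscale (of_nat m) u = to_rat a"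
    using common_denominator uv(1) by blast
  obtain n b where b: "n > 0" "b \<in> coord_space d" "fscale (of_nat n) v = to_rat b"
    using common_denominator uv(2) by blast
  have "to_rat (wedge a b) = fscale (of_nat (m * n)) (wedge u v)"
    by (simp add: to_rat_wedge flip: a b)
       (simp add: wedge_fscale_left wedge_fscale_right mult.commute)
  also have "\<dots> = to_rat (fscale (int (m * n)) w)"
    by (simp add: to_rat_fscale uv)
  finally have "wedge a b = fscale (int (m * n)) w"
    by simp
  then show thesis
    using wedge_factor[of "m * n"] a b that by (metis nat_0_less_mult_iff)
qed

section \<open>Existence of primitive generators\<close>

lemma rationalization_clear_denominator:
  assumes L: "int.subspace L" and x: "x \<in> rationalization L"
  shows "\<exists>n l. n > 0 \<and> l \<in> L \<and> fscale (of_int n) x = to_rat l"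
  using x unfolding rationalization_def
proof (induction rule: rat.span_induct_alt)
  case base
  show ?case
    using int.subspace_0[OF L] by (metis rat.scale_zero_right to_rat_0 zero_less_one)
next
  case (step c x y)
  obtain l where l: "l \<in> L" "x = to_rat l"
    using step by blast
  obtain n k where k: "n > 0" "k \<in> L" "fscale (of_int n) y = to_rat k"
    using step by blast
  obtain s t where st: "quotient_of c = (s, t)"
    by fastforce
  then have t: "t > 0" "c = of_int s / of_int t"
    using quotient_of_denom_pos quotient_of_div by blast+
  \<comment> \<open>The factor \<open>t\<close> clears the denominator of \<open>c\<close>, and
    \<open>n\<close> is the multiplier that the induction provides for \<open>y\<close>.\<close>
  have "fscale (of_int (n * t)) (fscale c x + y)
      = fscale (of_int (n * s)) x + fscale (of_int t) (fscale (of_int n) y)"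
    using t by (auto simp: fscale_def fun_eq_iff field_simps)
  also have "\<dots> = to_rat (fscale (n * s) l + fscale t k)"
    using l k by (simp only: to_rat_add to_rat_fscale)
  finally show ?case
    using k t l L by (metis int.subspace_add int.subspace_scale mult_pos_pos)
qed

text \<open>The coordinate \<open>k\<close> embeds \<open>G\<close> into the integers, and division
  with remainder shows that a nonzero element with least absolute value at \<open>k\<close>
  generates.\<close>

lemma cyclic_if_separated_by_coordinate:
  assumes G: "int.subspace G" and w: "w \<in> G" "w \<noteq> 0"
    and inj: "\<And>x. x \<in> G \<Longrightarrow> x k = 0 \<Longrightarrow> x = 0"
  shows "\<exists>q. q \<noteq> 0 \<and> G = int_span {q}"
proof -
  obtain q where q: "q \<in> G" "q \<noteq> 0"
    and min: "\<And>x. x \<in> G \<Longrightarrow> x \<noteq> 0 \<Longrightarrow> nat \<bar>q k\<bar> \<le> nat \<bar>x k\<bar>"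
    using ex_has_least_nat[of "\<lambda>x. x \<in> G \<and> x \<noteq> 0" w "\<lambda>x. nat \<bar>x k\<bar>"] w by blast
  have qk: "q k \<noteq> 0"
    using inj q by blast
  have "x \<in> int_span {q}" if "x \<in> G" for x
  proof -
    let ?y = "x - fscale (x k div q k) q"
    have "?y \<in> G"
      using G that q by (intro int.subspace_diff int.subspace_scale)
    moreover have "?y k = x k mod q k"
      by (simp add: fscale_def minus_div_mult_eq_mod)
    ultimately have "?y = 0"
      \<comment> \<open>The remainder is smaller than \<open>q k\<close> in absolute value, so a
        nonzero \<open>?y\<close> would contradict minimality.\<close>
      using min[of ?y] abs_mod_less[OF qk, of "x k"] by fastforce
    then show ?thesis
      by (metis eq_iff_diff_eq_0 int.span_base int.span_scale singletonI)
  qed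
  then show ?thesis
    using q int.span_minimal[of "{q}" G] G by (intro exI[of _ q]) auto
qed

text \<open>A positive multiple of \<omega> lies in the image of \<open>L\<close>, so the
  intersection is nonzero. Points of a line are determined by any coordinate at which \<omega> does
  not vanish, so the intersection is cyclic.\<close>

lemma primitive_generator_exists:
  assumes L: "int.subspace L" and P: "P \<subseteq> rationalization L" "P = rat_span {\<omega>}" "\<omega> \<noteq> 0"
  shows "\<exists>q. primitive_generator L P q"
proof -
  let ?G = "{w \<in> L. to_rat w \<in> P}"
  have "\<omega> \<in> P"
    using P by (simp add: rat.span_base)
  then obtain n l where l: "n > 0" "l \<in> L" "fscale (of_int n) \<omega> = to_rat l"
    using rationalization_clear_denominator[OF L] P by blast
  then have "l \<in> ?G"
    using \<open>\<omega> \<in> P\<close> P(2) by (metis (mono_tags, lifting) mem_Collect_eq rat.span_scale)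
  moreover have "l \<noteq> 0"
    using l P(3) by (metis fscale_eq_0_iff of_int_0_eq_iff less_irrefl to_rat_0)
  moreover have "int.subspace ?G"
    using L P(2) unfolding int.subspace_def
    by (auto simp: to_rat_add to_rat_fscale rat.span_add rat.span_scale rat.span_zero)
  moreover obtain k where "\<omega> k \<noteq> 0"
    using P(3) by (auto simp: fun_eq_iff)
  then have "x = 0" if "x \<in> ?G" "x k = 0" for x
  proof -
    have "to_rat x \<in> rat_span {\<omega>}"
      using that(1) P(2) by simp
    then obtain c where c: "to_rat x = fscale c \<omega>"
      unfolding rat.span_singleton by blast
    then have "c * \<omega> k = 0"
      using that(2) by (metis fscale_def to_rat_def of_int_0)
    then show ?thesis
      using c \<open>\<omega> k \<noteq> 0\<close> by (metis fscale_eq_0_iff mult_eq_0_iff to_rat_eq_0_iff)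
  qed
  ultimately show ?thesis
    unfolding primitive_generator_def using cyclic_if_separated_by_coordinate[of ?G l k] by blast
qed

section \<open>The kernel, its rational points and the group they generate\<close>

lemma subspace_ext_kernel:
  assumes "\<And>x y. x \<in> ext_square d \<Longrightarrow> y \<in> ext_square d \<Longrightarrow> \<beta> (x + y) = \<beta> x + \<beta> y"
  shows "int.subspace (ext_kernel d \<beta>)"
proof -
  have E: "int.subspace (ext_square d :: (nat \<times> nat \<Rightarrow> int) set)"
    by (rule subspace_ext_square)
  have zero: "0 \<in> ext_kernel d \<beta>"
    using assms[of 0 0] int.subspace_0[OF E] by (simp add: ext_kernel_def)
  have add: "x + y \<in> ext_kernel d \<beta>" if "x \<in> ext_kernel d \<beta>" "y \<in> ext_kernel d \<beta>" for x y
    using that assms int.subspace_add[OF E] by (simp add: ext_kernel_def)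
  have diff: "x - y \<in> ext_kernel d \<beta>" if "x \<in> ext_kernel d \<beta>" "y \<in> ext_kernel d \<beta>" for x y
  proof -
    have "x - y \<in> ext_square d"
      using that int.subspace_diff[OF E] by (simp add: ext_kernel_def)
    then show ?thesis
      using that assms[of "x - y" y] by (simp add: ext_kernel_def)
  qed
  have "fscale c x \<in> ext_kernel d \<beta>" if x: "x \<in> ext_kernel d \<beta>" for c x
  \<comment> \<open>Only additivity of \<beta> is given; integer multiples are reached from 0 by
    adding or subtracting \<open>x\<close>.\<close>
  proof (induction c rule: int_induct[of _ 0])
    case base
    then show ?case using zero by (metis int.scale_zero_left)
  next
    case (step1 i)
    then show ?case using add x by (metis int.scale_left_distrib int.scale_one)
  next
    case (step2 i)
    then show ?case using diff x by (metis int.scale_left_diff_distrib int.scale_one)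
  qed
  then show ?thesis
    using zero add by (simp add: int.subspace_def)
qed

text \<open>The right side is the target of the bijection in the theorem, which can therefore be the
  identity.\<close>

lemma X_points_eq:
  "X_points d L = {P. rat_subspace P \<and> P \<subseteq> rationalization L \<and> rat_dim P = 1 \<and>
     (\<exists>\<omega>. \<omega> \<noteq> 0 \<and> decomposable d \<omega> \<and> P = rat_span {\<omega>})}"
  by (auto simp: X_points_def proj_space_def pluecker_image_eq)

lemma decomposable_in_X_point:
  assumes "P \<in> X_points d L" "x \<in> P"
  shows "decomposable d x"
proof -
  obtain u v where uv: "u \<in> coord_space d" "v \<in> coord_space d" "P = rat_span {wedge u v}"
    using assms(1) by (auto simp: X_points_eq decomposable_def)
  then obtain c where "x = wedge (fscale c u) v"
    using assms(2) by (auto simp: rat.span_singleton wedge_fscale_left)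
  then show ?thesis
    using uv rat.subspace_scale[OF subspace_coord_space] by (auto simp: decomposable_def)
qed

theorem proposition3p4:
  fixes d :: nat
    and \<beta> :: "(nat \<times> nat \<Rightarrow> int) \<Rightarrow> 'w::ab_group_add"
    and L :: "(nat \<times> nat \<Rightarrow> int) set"
  assumes W_free: "free_abelian TYPE('w)"
    and \<beta>_hom: "\<And>x y. x \<in> ext_square d \<Longrightarrow> y \<in> ext_square d \<Longrightarrow> \<beta> (x + y) = \<beta> x + \<beta> y"
    and \<beta>_onto: "\<beta> ` ext_square d = UNIV"
    and L_def: "L = ext_kernel d \<beta>"
  shows "(bij_betw (\<lambda>P. P) (X_points d L)
           {P. rat_subspace P \<and> P \<subseteq> rationalization L \<and> rat_dim P = 1 \<and>
               (\<exists>\<omega>. \<omega> \<noteq> 0 \<and> decomposable d \<omega> \<and> P = rat_span {\<omega>})})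
         \<and> (\<forall>P\<in>X_points d L. \<exists>q. primitive_generator L P q)
         \<and> (\<forall>q. (\<forall>P\<in>X_points d L. primitive_generator L P (q P)) \<longrightarrow>
           D_group d \<beta> = int_span (q ` X_points d L))
         \<and> (D_group d \<beta> \<noteq> {0} \<longleftrightarrow> X_points d L \<noteq> {})"
proof -
  have L: "int.subspace L"
    unfolding L_def using \<beta>_hom by (rule subspace_ext_kernel)
  let ?S = "{wedge a b | a b. a \<in> coord_space d \<and> b \<in> coord_space d \<and> \<beta> (wedge a b) = 0}"
  have ex: "\<exists>q. primitive_generator L P q" if "P \<in> X_points d L" for P
    using that primitive_generator_exists[OF L] by (auto simp: X_points_eq)
  \<comment> \<open>A primitive generator is decomposable over the rationals because it lies on
    \<open>P\<close>, hence over the integers, and \<beta> kills it.\<close>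
  have gen_in: "q \<in> ?S" if P: "P \<in> X_points d L" and q: "primitive_generator L P q" for P q
  proof -
    have "q \<in> {w \<in> L. to_rat w \<in> P}"
      using q by (simp add: primitive_generator_def int.span_base)
    then have "q \<in> L" "decomposable d (to_rat q)"
      using P decomposable_in_X_point by auto
    moreover obtain a b where "a \<in> coord_space d" "b \<in> coord_space d" "q = wedge a b"
      using \<open>decomposable d (to_rat q)\<close> by (rule decomposable_to_rat_obtain)
    ultimately show ?thesis
      by (auto simp: L_def ext_kernel_def)
  qed
  have D: "D_group d \<beta> = int_span (q ` X_points d L)"
    if q: "\<forall>P\<in>X_points d L. primitive_generator L P (q P)" for q
  proof -
    have "wedge a b \<in> int_span (q ` X_points d L)"
      if ab: "a \<in> coord_space d" "b \<in> coord_space d" "\<beta> (wedge a b) = 0" for a b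
    proof (cases "wedge a b = 0")
      case True
      then show ?thesis by (simp add: int.span_zero)
    next
      case False
      let ?w = "to_rat (wedge a b)"
      \<comment> \<open>The rational point through a nonzero generator of \<open>D_group\<close>;
        its intersection with \<open>L\<close> contains \<open>wedge a b\<close>, which is thus a
        multiple of \<open>q ?P\<close>.\<close>
      let ?P = "rat_span {?w}"
      have w: "wedge a b \<in> L"
        using ab by (simp add: L_def ext_kernel_def wedge_in_ext_square)
      then have "?P \<subseteq> rationalization L"
        unfolding rationalization_def by (intro rat.span_mono) auto
      moreover have "decomposable d ?w"
        using ab to_rat_in_coord_space by (auto simp: decomposable_def to_rat_wedge)
      moreover have "?w \<noteq> 0"
        using False by simp
      ultimately have P: "?P \<in> X_points d L"
        using rat_dim_span_singleton by (auto simp only: X_points_eq rat.subspace_span)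
      then have "{x \<in> L. to_rat x \<in> ?P} = int_span {q ?P}"
        using q unfolding primitive_generator_def by blast
      then have "wedge a b \<in> int_span {q ?P}"
        using w rat.span_base by blast
      then show ?thesis
        using P int.span_mono[of "{q ?P}" "q ` X_points d L"] by blast
    qed
    moreover have "q ` X_points d L \<subseteq> ?S"
      using gen_in q by blast
    ultimately show ?thesis
      unfolding D_group_def
      by (intro int.span_eq[THEN iffD2] conjI subset_trans[OF _ int.span_superset[of ?S]]) auto
  qed
  obtain q where q: "\<forall>P\<in>X_points d L. primitive_generator L P (q P)"
    using ex by metis
  have "D_group d \<beta> \<noteq> {0} \<longleftrightarrow> X_points d L \<noteq> {}"
  proof
    show "X_points d L \<noteq> {}" if "D_group d \<beta> \<noteq> {0}"
      \<comment> \<open>Without rational points the span is that of the empty set, namely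
        zero.\<close>
      using that D[OF q] by auto
    show "D_group d \<beta> \<noteq> {0}" if "X_points d L \<noteq> {}"
    proof -
      from that obtain P where P: "P \<in> X_points d L"
        by blast
      then have "q P \<in> D_group d \<beta>" "q P \<noteq> 0"
        using D[OF q] q by (auto simp: primitive_generator_def int.span_base)
      then show ?thesis by blast
    qed
  qed
  then show ?thesis
    using ex D by (simp only: X_points_eq[symmetric]) (auto simp: bij_betw_def)
qed

end
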